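(* The string $0212$ has sorting distance $3$. Every other normalized fully ternary string $s$ of length $n$ ending in the symbol $2$ has $d_{\rm s}(s)=n-2$ if $s$ is bad and $d_{\rm s}(s)=n-3$ if $s$ is good. A normalized fully ternary string $s$ ending in $0$ or $1$ has the same sorting distance as the string $s2$ ($s$ followed by the symbol $2$).
   Context: Strings are finite words over $\{0,1,2,\dots\}$. A string is \emph{normalized} if no two adjacent symbols are equal; the \emph{normalization} of a string replaces every maximal run of identical symbols by a single copy. A string is \emph{fully $k$-ary} if the set of symbols occurring in it is exactly $\{0,\dots,k-1\}$; fully ternary means fully $3$-ary. For a normalized string $s=s_1\cdots s_n$ and $1\le i\le n$, the flip $f^{(i)}(s)$ is the normalization of $s_i\cdots s_1 s_{i+1}\cdots s_n$. The sorting distance $d_{\rm s}(s)$ of a normalized fully ternary string is the minimum number of flips needed to transform $s$ into $012$. Regular-expression notation: $w^i$ is $i$ repetitions of $w$, $w^*$ is zero or more, $w^+$ one or more, $w^{\ge 2}$ two or more repetitions; $\{a,b\}$ denotes a single symbol that is either $a$ or $b$ (chosen independently at each occurrence). A normalized fully ternary string ending in $2$ is \emph{bad} (for sorting; no relabelling allowed) if it is of one of the following types: (I) $0(12)^{\ge 2}$; (II) $(\{0,1\}2)^+$ or $2(\{0,1\}2)^+$; (III) $(\{1,2\}0)^+2$ or $0(\{1,2\}0)^+2$; (IV) $(\{1,2\}0)^+12$ or $(0\{1,2\})^+012$, in either case containing at least two occurrences of $2$; (V) $(01)^*0212$ or $(10)^+212$; (VI) $1(20)^+1(20)^*2$ or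 $0(21)^+0(21)^*2$; (VII) $1(02)^+1(02)^+$; (VIII) $1(02)^+12$; (IX) one of the following 77 strings: 210212, 021012, 212012, 120102, 201202, 0210202, 1021202, 0212012, 2120102, 0102102, 1212012, 2010212, 0120212, 1201012, 1201212, 2012012, 10210212, 21021212, 02102012, 02101212, 10212012, 02121012, 02120102, 10102102, 02010212, 21202012, 21201012, 21201202, 20210212, 01021202, 01020212, 20212012, 12120102, 12010212, 12010202, 20120102, 12012012, 021021202, 102120102, 102010212, 021202012, 021201012, 020210212, 101020212, 020212012, 212010202, 212012012, 010210212, 010210202, 010212012, 202010212, 121202012, 121201202, 201021202, 120212012, 012021212, 120102012, 201202012, 120120212, 201201012, 0210212012, 1021202012, 1021201012, 1020210212, 1010210202, 0202010212, 2120202012, 2120102012, 2021021212, 2010212012, 1201021202, 1201202012, 10202010212, 02120102012, 02021021212, 21201202012, 12120202012. All other normalized fully ternary strings ending in $2$ are \emph{good}. (In particular $0212$ is bad, of type V.) *)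

theory Defs
  imports Main "HOL-Library.Extended_Nat"
begin

definition normalized :: "nat list \<Rightarrow> bool" where
  "normalized s \<longleftrightarrow> successively (\<noteq>) s"

definition normalization :: "nat list \<Rightarrow> nat list" where
  "normalization s = remdups_adj s"

definition fully_kary :: "nat \<Rightarrow> nat list \<Rightarrow> bool" where
  "fully_kary k s \<longleftrightarrow> set s = {0..<k}"

abbreviation fully_ternary :: "nat list \<Rightarrow> bool" where
  "fully_ternary s \<equiv> fully_kary 3 s"

definition flip :: "nat \<Rightarrow> nat list \<Rightarrow> nat list" where
  "flip i s = normalization (rev (take i s) @ drop i s)"

definition flip_step :: "nat list \<Rightarrow> nat list \<Rightarrow> bool" where
  "flip_step s t \<longleftrightarrow> (\<exists>i. 1 \<le> i \<and> i \<le> length s \<and> t = flip i s)"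

text \<open>Sorting distance: least number of flips to reach 012 (infinity if unreachable).\<close>
definition sorting_dist :: "nat list \<Rightarrow> enat" where
  "sorting_dist s = (INF k \<in> {k. (flip_step ^^ k) s [0,1,2]}. enat k)"

definition lconc :: "nat list set \<Rightarrow> nat list set \<Rightarrow> nat list set" (infixr "\<cdot>" 75) where
  "A \<cdot> B = {x @ y | x y. x \<in> A \<and> y \<in> B}"

fun lpow :: "nat list set \<Rightarrow> nat \<Rightarrow> nat list set" where
  "lpow A 0 = {[]}"
| "lpow A (Suc n) = A \<cdot> lpow A n"

definition lrep_ge :: "nat \<Rightarrow> nat list set \<Rightarrow> nat list set" where
  "lrep_ge m A = (\<Union>n\<in>{m..}. lpow A n)"

abbreviation lstar :: "nat list set \<Rightarrow> nat list set" where
  "lstar A \<equiv> lrep_ge 0 A"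

abbreviation lplus :: "nat list set \<Rightarrow> nat list set" where
  "lplus A \<equiv> lrep_ge 1 A"

abbreviation wd :: "nat list \<Rightarrow> nat list set" where
  "wd w \<equiv> {w}"

definition ch :: "nat \<Rightarrow> nat \<Rightarrow> nat list set" where
  "ch a b = {[a], [b]}"

definition typeI :: "nat list set" where
  "typeI = wd [0] \<cdot> lrep_ge 2 (wd [1,2])"

definition typeII :: "nat list set" where
  "typeII = lplus (ch 0 1 \<cdot> wd [2]) \<union> wd [2] \<cdot> lplus (ch 0 1 \<cdot> wd [2])"

definition typeIII :: "nat list set" where
  "typeIII = lplus (ch 1 2 \<cdot> wd [0]) \<cdot> wd [2]
           \<union> wd [0] \<cdot> lplus (ch 1 2 \<cdot> wd [0]) \<cdot> wd [2]"

definition typeIV :: "nat list set" where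
  "typeIV = {s. (s \<in> lplus (ch 1 2 \<cdot> wd [0]) \<cdot> wd [1,2]
               \<or> s \<in> lplus (wd [0] \<cdot> ch 1 2) \<cdot> wd [0,1,2])
             \<and> count_list s 2 \<ge> 2}"

definition typeV :: "nat list set" where
  "typeV = lstar (wd [0,1]) \<cdot> wd [0,2,1,2] \<union> lplus (wd [1,0]) \<cdot> wd [2,1,2]"

definition typeVI :: "nat list set" where
  "typeVI = wd [1] \<cdot> lplus (wd [2,0]) \<cdot> wd [1] \<cdot> lstar (wd [2,0]) \<cdot> wd [2]
          \<union> wd [0] \<cdot> lplus (wd [2,1]) \<cdot> wd [0] \<cdot> lstar (wd [2,1]) \<cdot> wd [2]"

definition typeVII :: "nat list set" where
  "typeVII = wd [1] \<cdot> lplus (wd [0,2]) \<cdot> wd [1] \<cdot> lplus (wd [0,2])"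

definition typeVIII :: "nat list set" where
  "typeVIII = wd [1] \<cdot> lplus (wd [0,2]) \<cdot> wd [1,2]"

definition typeIX :: "nat list set" where
  "typeIX = set
  [ [2,1,0,2,1,2],
   [0,2,1,0,1,2],
   [2,1,2,0,1,2],
   [1,2,0,1,0,2],
   [2,0,1,2,0,2],
   [0,2,1,0,2,0,2],
   [1,0,2,1,2,0,2],
   [0,2,1,2,0,1,2],
   [2,1,2,0,1,0,2],
   [0,1,0,2,1,0,2],
   [1,2,1,2,0,1,2],
   [2,0,1,0,2,1,2],
   [0,1,2,0,2,1,2],
   [1,2,0,1,0,1,2],
   [1,2,0,1,2,1,2],
   [2,0,1,2,0,1,2],
   [1,0,2,1,0,2,1,2],
   [2,1,0,2,1,2,1,2],
   [0,2,1,0,2,0,1,2],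
   [0,2,1,0,1,2,1,2],
   [1,0,2,1,2,0,1,2],
   [0,2,1,2,1,0,1,2],
   [0,2,1,2,0,1,0,2],
   [1,0,1,0,2,1,0,2],
   [0,2,0,1,0,2,1,2],
   [2,1,2,0,2,0,1,2],
   [2,1,2,0,1,0,1,2],
   [2,1,2,0,1,2,0,2],
   [2,0,2,1,0,2,1,2],
   [0,1,0,2,1,2,0,2],
   [0,1,0,2,0,2,1,2],
   [2,0,2,1,2,0,1,2],
   [1,2,1,2,0,1,0,2],
   [1,2,0,1,0,2,1,2],
   [1,2,0,1,0,2,0,2],
   [2,0,1,2,0,1,0,2],
   [1,2,0,1,2,0,1,2],
   [0,2,1,0,2,1,2,0,2],
   [1,0,2,1,2,0,1,0,2],
   [1,0,2,0,1,0,2,1,2],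
   [0,2,1,2,0,2,0,1,2],
   [0,2,1,2,0,1,0,1,2],
   [0,2,0,2,1,0,2,1,2],
   [1,0,1,0,2,0,2,1,2],
   [0,2,0,2,1,2,0,1,2],
   [2,1,2,0,1,0,2,0,2],
   [2,1,2,0,1,2,0,1,2],
   [0,1,0,2,1,0,2,1,2],
   [0,1,0,2,1,0,2,0,2],
   [0,1,0,2,1,2,0,1,2],
   [2,0,2,0,1,0,2,1,2],
   [1,2,1,2,0,2,0,1,2],
   [1,2,1,2,0,1,2,0,2],
   [2,0,1,0,2,1,2,0,2],
   [1,2,0,2,1,2,0,1,2],
   [0,1,2,0,2,1,2,1,2],
   [1,2,0,1,0,2,0,1,2],
   [2,0,1,2,0,2,0,1,2],
   [1,2,0,1,2,0,2,1,2],
   [2,0,1,2,0,1,0,1,2],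
   [0,2,1,0,2,1,2,0,1,2],
   [1,0,2,1,2,0,2,0,1,2],
   [1,0,2,1,2,0,1,0,1,2],
   [1,0,2,0,2,1,0,2,1,2],
   [1,0,1,0,2,1,0,2,0,2],
   [0,2,0,2,0,1,0,2,1,2],
   [2,1,2,0,2,0,2,0,1,2],
   [2,1,2,0,1,0,2,0,1,2],
   [2,0,2,1,0,2,1,2,1,2],
   [2,0,1,0,2,1,2,0,1,2],
   [1,2,0,1,0,2,1,2,0,2],
   [1,2,0,1,2,0,2,0,1,2],
   [1,0,2,0,2,0,1,0,2,1,2],
   [0,2,1,2,0,1,0,2,0,1,2],
   [0,2,0,2,1,0,2,1,2,1,2],
   [2,1,2,0,1,2,0,2,0,1,2],
   [1,2,1,2,0,2,0,2,0,1,2]]"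

text \<open>Bad (for a normalized fully ternary string ending in 2): membership in one of the types.\<close>
definition bad :: "nat list \<Rightarrow> bool" where
  "bad s \<longleftrightarrow> s \<in> typeI \<union> typeII \<union> typeIII \<union> typeIV \<union> typeV \<union> typeVI
                  \<union> typeVII \<union> typeVIII \<union> typeIX"

definition good :: "nat list \<Rightarrow> bool" where
  "good s \<longleftrightarrow> \<not> bad s"

end

theory Submission
  imports Defs "HOL-Library.Sublist"
begin

text \<open>A flip shortens a normalized string, by one symbol, only if it has the form \<open>a w a v \<mapsto> w\<^sup>R a v\<close>.
  Call the results the children of the string. For strings ending in 2, every child of a bad
  string is bad, so a bad string needs one flip that does not shorten it; a good string longer
  than 3 has a good child, so it can be sorted by shortening flips only. A flip sequence for a
  string induces one, of the same length, for each of its normalized subsequences; hence a bad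
  string other than 0212 is sorted within the distance of a good string obtained by inserting one
  symbol, and a string \<open>s\<close> not ending in 2 is no farther than \<open>s2\<close>.

  Types I--VIII form a regular language, recognized by an automaton with 32 states. The statements
  about children and insertions become finite closure computations on states, with a length bound
  beyond which they hold uniformly; type IX and the short strings are checked one by one.\<close>

section \<open>The regular types as an automaton\<close>

text \<open>Each of types I--VIII is a union of concatenations of symbol classes and stars of
  fixed-length words over such classes. This fragment is closed under residuals, since a star body
  cut after its first letter is a list of \<open>Sym\<close> blocks.\<close>

datatype block = Sym "nat list" | Rep "nat list list"

definition words_of :: "nat list list \<Rightarrow> nat list set" where
  "words_of p = {w. list_all2 (\<lambda>a A. a \<in> set A) w p}"

primrec block_lang :: "block \<Rightarrow> nat list set" where
  "block_lang (Sym A) = words_of [A]"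
| "block_lang (Rep p) = lstar (words_of p)"

primrec pattern_lang :: "block list \<Rightarrow> nat list set" where
  "pattern_lang [] = {[]}"
| "pattern_lang (b # r) = block_lang b \<cdot> pattern_lang r"

text \<open>Antimirov's partial derivatives: a repetition is either entered, which leaves the rest
  of its body in front of the same repetition, or skipped.\<close>

primrec residuals :: "nat \<Rightarrow> block list \<Rightarrow> block list list" where
  "residuals a [] = []"
| "residuals a (b # r) =
    (case b of
       Sym A \<Rightarrow> if a \<in> set A then [r] else []
     | Rep p \<Rightarrow> (case p of [] \<Rightarrow> []
               | A # p' \<Rightarrow> if a \<in> set A then [map Sym p' @ b # r] else []) @ residuals a r)"

fun is_rep :: "block \<Rightarrow> bool" where
  "is_rep (Sym A) = False"
| "is_rep (Rep p) = True"

section \<open>Language identities and correctness of residuals\<close>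

lemma lconc_assoc: "(A \<cdot> B) \<cdot> C = A \<cdot> B \<cdot> C"
  unfolding lconc_def by (auto, metis append.assoc, metis append.assoc)

lemma lconc_Nil [simp]: "{[]} \<cdot> A = A" "A \<cdot> {[]} = A"
  by (auto simp: lconc_def)

lemma lconc_Un: "(A \<union> B) \<cdot> C = A \<cdot> C \<union> B \<cdot> C" "C \<cdot> (A \<union> B) = C \<cdot> A \<union> C \<cdot> B"
  by (auto simp: lconc_def)

lemma lconc_UN: "A \<cdot> (\<Union>k\<in>K. B k) = (\<Union>k\<in>K. A \<cdot> B k)"
  unfolding lconc_def by blast

lemma lrep_ge_Suc: "lrep_ge (Suc n) A = A \<cdot> lrep_ge n A"
proof -
  have "{Suc n..} = Suc ` {n..}"
  proof (rule set_eqI)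
    show "k \<in> {Suc n..} \<longleftrightarrow> k \<in> Suc ` {n..}" for k
      by (cases k) auto
  qed
  then show ?thesis
    unfolding lrep_ge_def lconc_UN by (metis (no_types, lifting) SUP_cong image_image lpow.simps(2))
qed

lemma lstar_unfold: "lstar A = {[]} \<union> A \<cdot> lstar A"
proof -
  have zero: "{0..} = insert (0 :: nat) {Suc 0..}"
    by (rule set_eqI) (simp add: not_less_eq_eq[symmetric] disj_commute, arith)
  have "lstar A = {[]} \<union> lrep_ge (Suc 0) A"
    by (simp only: lrep_ge_def zero UN_insert lpow.simps(1))
  then show ?thesis by (simp only: lrep_ge_Suc)
qed

lemma Nil_in_lconc [simp]: "[] \<in> A \<cdot> B \<longleftrightarrow> [] \<in> A \<and> [] \<in> B"
  by (auto simp: lconc_def)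

lemma words_of_Nil [simp]: "words_of [] = {[]}"
  by (auto simp: words_of_def)

lemma words_of_single: "words_of [A] = (\<lambda>a. [a]) ` set A"
  by (auto simp: words_of_def list_all2_Cons2)

lemma in_words_of_lconc: "v \<in> words_of [A] \<cdot> X \<longleftrightarrow> (\<exists>a\<in>set A. \<exists>w\<in>X. v = a # w)"
  (is "?L = ?R")
proof
  assume ?L
  then obtain x y where "v = x @ y" "x \<in> (\<lambda>a. [a]) ` set A" "y \<in> X"
    unfolding words_of_single lconc_def by blast
  then show ?R by auto
next
  assume ?R
  then obtain a w where *: "a \<in> set A" "w \<in> X" "v = [a] @ w" by auto
  then have "[a] \<in> (\<lambda>a. [a]) ` set A" by blast
  with * show ?L unfolding words_of_single lconc_def by blast
qed

lemma words_of_Cons: "words_of (A # p) = words_of [A] \<cdot> words_of p"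
proof (rule set_eqI)
  show "w \<in> words_of (A # p) \<longleftrightarrow> w \<in> words_of [A] \<cdot> words_of p" for w
    unfolding in_words_of_lconc by (cases w) (simp_all add: words_of_def)
qed

lemma Cons_in_words_of_lconc:
  "a # w \<in> words_of (A # p) \<cdot> X \<longleftrightarrow> a \<in> set A \<and> w \<in> words_of p \<cdot> X"
  unfolding words_of_Cons[of A p] lconc_assoc by (simp add: in_words_of_lconc)

lemma pattern_lang_append: "pattern_lang (map Sym p @ r) = words_of p \<cdot> pattern_lang r"
proof (induction p)
  case (Cons A p)
  then show ?case by (simp add: lconc_assoc words_of_Cons[of A p])
qed simp

lemma lstar_epsilon: "lstar {[]} = {[]}"
proof -
  have "lpow {[]} n = {[]}" for n by (induction n) simp_all
  then show ?thesis by (simp add: lrep_ge_def)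
qed

text \<open>Unfolding a star once separates zero copies from a first copy, which supplies the letter
  \<open>a\<close>. An empty body is treated apart, its star being just the empty word.\<close>

lemma Cons_in_pattern_lang: "a # w \<in> pattern_lang r \<longleftrightarrow> (\<exists>r'\<in>set (residuals a r). w \<in> pattern_lang r')"
proof (induction r)
  case (Cons b r)
  show ?case
  proof (cases b)
    case (Sym A)
    then show ?thesis by (simp add: Cons_in_words_of_lconc)
  next
    case (Rep p)
    show ?thesis
    proof (cases p)
      case Nil
      then show ?thesis using Rep Cons by (simp add: lstar_epsilon)
    next
      case (Cons A p')
      have "block_lang b \<cdot> pattern_lang r
          = pattern_lang r \<union> words_of p \<cdot> block_lang b \<cdot> pattern_lang r"
        unfolding Rep block_lang.simps
        by (subst lstar_unfold) (simp only: lconc_Un lconc_assoc lconc_Nil)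
      then show ?thesis
        using Rep Cons Cons.IH
        by (auto simp: Cons_in_words_of_lconc pattern_lang_append)
    qed
  qed
qed simp

lemma Nil_in_pattern_lang: "[] \<in> pattern_lang r \<longleftrightarrow> list_all is_rep r"
proof (induction r)
  case (Cons b r)
  have "[] \<in> lstar A" for A by (subst lstar_unfold) simp
  then show ?case using Cons by (cases b) (auto simp: words_of_def)
qed simp

text \<open>An item \<open>(k, r)\<close> stands for the words of the pattern \<open>r\<close> with at least \<open>k\<close> occurrences
  of the symbol 2.\<close>

definition item_lang :: "(nat \<times> block list) list \<Rightarrow> nat list set" where
  "item_lang I = {w. \<exists>(k, r)\<in>set I. w \<in> pattern_lang r \<and> k \<le> count_list w 2}"

text \<open>Truncated subtraction keeps a requirement that is already met at 0; merging equal items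
  keeps the lists short during exploration.\<close>

definition item_step :: "nat \<Rightarrow> (nat \<times> block list) list \<Rightarrow> (nat \<times> block list) list" where
  "item_step a I = remdups (concat (map
     (\<lambda>(k, r). map (Pair (if a = 2 then k - 1 else k)) (residuals a r)) I))"

definition item_accepting :: "(nat \<times> block list) list \<Rightarrow> bool" where
  "item_accepting I = list_ex (\<lambda>(k, r). k = 0 \<and> list_all is_rep r) I"

lemma Cons_in_item_lang: "a # w \<in> item_lang I \<longleftrightarrow> w \<in> item_lang (item_step a I)"
proof -
  have "(\<exists>(k', r')\<in>set (item_step a I). w \<in> pattern_lang r' \<and> k' \<le> count_list w 2) \<longleftrightarrow>
      (\<exists>(k, r)\<in>set I. \<exists>r'\<in>set (residuals a r).
         w \<in> pattern_lang r' \<and> (if a = 2 then k - 1 else k) \<le> count_list w 2)"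
    by (simp add: item_step_def split_def)
  moreover have "(if a = 2 then k - 1 else k) \<le> count_list w 2 \<longleftrightarrow> k \<le> count_list (a # w) 2" for k
    by auto
  ultimately show ?thesis
    by (simp add: item_lang_def Cons_in_pattern_lang split_def)
qed

lemma Nil_in_item_lang: "[] \<in> item_lang I \<longleftrightarrow> item_accepting I"
  by (auto simp: item_lang_def item_accepting_def list_ex_iff Nil_in_pattern_lang)

text \<open>The 13 alternatives of types I--VIII in order, with one copy split off each plus and two
  copies off the repetition in type I. The bound 2 is the side condition of type IV.\<close>

definition bad_items :: "(nat \<times> block list) list" where
  "bad_items = (let s = (\<lambda>a. Sym [a]); r = (\<lambda>a b. Rep [[a], [b]]) in
   [(0, [s 0, s 1, s 2, s 1, s 2, r 1 2]),
    (0, [Sym [0, 1], s 2, Rep [[0, 1], [2]]]),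
    (0, [s 2, Sym [0, 1], s 2, Rep [[0, 1], [2]]]),
    (0, [Sym [1, 2], s 0, Rep [[1, 2], [0]], s 2]),
    (0, [s 0, Sym [1, 2], s 0, Rep [[1, 2], [0]], s 2]),
    (2, [Sym [1, 2], s 0, Rep [[1, 2], [0]], s 1, s 2]),
    (2, [s 0, Sym [1, 2], Rep [[0], [1, 2]], s 0, s 1, s 2]),
    (0, [r 0 1, s 0, s 2, s 1, s 2]),
    (0, [s 1, s 0, r 1 0, s 2, s 1, s 2]),
    (0, [s 1, s 2, s 0, r 2 0, s 1, r 2 0, s 2]),
    (0, [s 0, s 2, s 1, r 2 1, s 0, r 2 1, s 2]),
    (0, [s 1, s 0, s 2, r 0 2, s 1, s 0, s 2, r 0 2]),
    (0, [s 1, s 0, s 2, r 0 2, s 1, s 2])])"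

section \<open>Types I--VIII as patterns\<close>

lemma wd_words_of: "wd [] = words_of []" "wd [a] = words_of [[a]]"
  "wd (a # b # w) = words_of [[a]] \<cdot> wd (b # w)"
  by (auto simp: words_of_def lconc_def list_all2_Cons2)

lemma ch_words_of: "ch a b = words_of [[a, b]]"
  by (auto simp: words_of_def list_all2_Cons2 ch_def)

lemma typeIV_eq: "typeIV = (lplus (ch 1 2 \<cdot> wd [0]) \<cdot> wd [1,2]
    \<union> lplus (wd [0] \<cdot> ch 1 2) \<cdot> wd [0,1,2]) \<inter> {w. 2 \<le> count_list w 2}"
  by (auto simp: typeIV_def)

lemma item_lang_Nil: "item_lang [] = {}"
  by (simp add: item_lang_def)

lemma item_lang_Cons:
  "item_lang ((k, r) # I) = (pattern_lang r \<inter> {w. k \<le> count_list w 2}) \<union> item_lang I"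
  by (auto simp: item_lang_def)

lemma lplus_unfold: "lplus A = A \<cdot> lstar A" "lrep_ge 2 A = A \<cdot> A \<cdot> lstar A"
  by (simp_all only: One_nat_def numeral_2_eq_2 lrep_ge_Suc)

lemma item_lang_bad_items:
  "item_lang bad_items = typeI \<union> typeII \<union> typeIII \<union> typeIV \<union> typeV \<union> typeVI \<union> typeVII \<union> typeVIII"
proof -
  have star: "lstar (words_of [A] \<cdot> words_of [B]) = lstar (words_of [A, B])" for A B
    by (simp add: words_of_Cons[of A "[B]"])
  show ?thesis
    unfolding typeI_def typeII_def typeIII_def typeIV_eq typeV_def typeVI_def typeVII_def typeVIII_def
      bad_items_def Let_def item_lang_Cons item_lang_Nil pattern_lang.simps block_lang.simps
      lplus_unfold wd_words_of ch_words_of star lconc_assoc lconc_Nil Int_Un_distrib2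
    by (simp add: Un_assoc lconc_assoc Int_Un_distrib2)
qed

text \<open>The minimal automaton of types I--VIII; \<open>node q\<close> lists acceptance and the successors of \<open>q\<close>
  for the symbols 0, 1, 2. The initial state is \<open>Q0\<close> and the sink is \<open>Q4\<close>.\<close>

datatype state =
  Q0 | Q1 | Q2 | Q3 | Q4 | Q5 | Q6 | Q7 | Q8 | Q9 | Q10
  | Q11 | Q12 | Q13 | Q14 | Q15 | Q16 | Q17 | Q18 | Q19 | Q20 | Q21
  | Q22 | Q23 | Q24 | Q25 | Q26 | Q27 | Q28 | Q29 | Q30 | Q31

primrec node :: "state \<Rightarrow> bool \<times> state \<times> state \<times> state" where
  "node Q0 = (False, Q1, Q2, Q3)"
| "node Q1 = (False, Q4, Q5, Q6)"
| "node Q2 = (False, Q7, Q4, Q8)"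
| "node Q3 = (False, Q9, Q10, Q4)"
| "node Q4 = (False, Q4, Q4, Q4)"
| "node Q5 = (False, Q11, Q4, Q12)"
| "node Q6 = (True, Q9, Q13, Q4)"
| "node Q7 = (False, Q4, Q14, Q15)"
| "node Q8 = (True, Q16, Q10, Q4)"
| "node Q9 = (False, Q4, Q17, Q18)"
| "node Q10 = (False, Q4, Q4, Q19)"
| "node Q11 = (False, Q4, Q14, Q20)"
| "node Q12 = (False, Q4, Q21, Q4)"
| "node Q13 = (False, Q21, Q4, Q22)"
| "node Q14 = (False, Q11, Q4, Q4)"
| "node Q15 = (True, Q23, Q24, Q4)"
| "node Q16 = (False, Q4, Q25, Q8)"
| "node Q17 = (False, Q26, Q4, Q27)"
| "node Q18 = (True, Q9, Q10, Q4)"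
| "node Q19 = (True, Q10, Q10, Q4)"
| "node Q20 = (True, Q26, Q28, Q4)"
| "node Q21 = (False, Q4, Q4, Q29)"
| "node Q22 = (True, Q10, Q13, Q4)"
| "node Q23 = (False, Q4, Q17, Q15)"
| "node Q24 = (False, Q25, Q4, Q27)"
| "node Q25 = (False, Q4, Q4, Q30)"
| "node Q26 = (False, Q4, Q17, Q31)"
| "node Q27 = (True, Q4, Q4, Q4)"
| "node Q28 = (False, Q4, Q4, Q27)"
| "node Q29 = (True, Q4, Q21, Q4)"
| "node Q30 = (True, Q25, Q4, Q4)"
| "node Q31 = (True, Q26, Q4, Q4)"

definition accepting :: "state \<Rightarrow> bool" where
  "accepting q = fst (node q)"

definition delta :: "state \<Rightarrow> nat \<Rightarrow> state" where
  "delta q a = (case node q of (_, x, y, z) \<Rightarrow> case a of 0 \<Rightarrow> x | Suc b \<Rightarrow> (case b of 0 \<Rightarrow> y | Suc _ \<Rightarrow> z))"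

abbreviation run :: "state \<Rightarrow> nat list \<Rightarrow> state" where
  "run \<equiv> foldl delta"

section \<open>Exploration of finite closures\<close>

fun explore_step :: "('a \<Rightarrow> 'a list) \<Rightarrow> 'a list \<times> 'a list \<Rightarrow> 'a list \<times> 'a list" where
  "explore_step f ([], seen) = ([], seen)"
| "explore_step f (x # xs, seen) = (if x \<in> set seen then (xs, seen) else (f x @ xs, x # seen))"

text \<open>Doubling (\<open>2 ^ n\<close> steps) keeps the fuel small in symbolic evaluation.\<close>

primrec explore :: "('a \<Rightarrow> 'a list) \<Rightarrow> nat \<Rightarrow> 'a list \<times> 'a list \<Rightarrow> 'a list \<times> 'a list" where
  "explore f 0 s = explore_step f s"
| "explore f (Suc n) s = explore f n (explore f n s)"

text \<open>The search gets \<open>2 ^ 8\<close> steps, and a nonempty worklist at the end counts as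
  failure, so success certifies that the closure was computed completely.\<close>

definition closure_check :: "('a \<Rightarrow> bool) \<Rightarrow> ('a \<Rightarrow> 'a list) \<Rightarrow> 'a \<Rightarrow> bool" where
  "closure_check P f x = (case explore f 8 ([x], []) of (todo, seen) \<Rightarrow> todo = [] \<and> list_all P seen)"

text \<open>The loop invariant of the search: once nothing is pending, the elements seen are closed
  under \<open>f\<close>.\<close>

definition explored :: "('a \<Rightarrow> 'a list) \<Rightarrow> 'a \<Rightarrow> 'a list \<times> 'a list \<Rightarrow> bool" where
  "explored f x s \<longleftrightarrow> x \<in> set (fst s) \<union> set (snd s) \<and>
     (\<forall>y\<in>set (snd s). set (f y) \<subseteq> set (fst s) \<union> set (snd s))"

lemma explored_step:
  assumes "explored f x s"
  shows "explored f x (explore_step f s)"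
proof -
  obtain todo seen where s: "s = (todo, seen)" by (cases s)
  show ?thesis
  proof (cases todo)
    case Nil
    then show ?thesis using assms s by simp
  next
    case (Cons y ys)
    have "set todo = insert y (set ys)" using Cons by simp
    then show ?thesis
      using assms unfolding s Cons explored_def
      by (cases "y \<in> set seen") (simp_all add: insert_absorb, blast+)
  qed
qed

lemma explored_explore: "explored f x s \<Longrightarrow> explored f x (explore f n s)"
  by (induction n arbitrary: s) (simp_all add: explored_step)

text \<open>The set obtained serves as an inductive invariant: each later argument about runs is an
  induction on a word that stays inside \<open>R\<close>.\<close>

lemma closure_check:
  assumes "closure_check P f x"
  shows "\<exists>R. x \<in> R \<and> (\<forall>y\<in>R. P y \<and> set (f y) \<subseteq> R)"
proof -
  obtain seen where seen: "explore f 8 ([x], []) = ([], seen)" "list_all P seen"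
    using assms unfolding closure_check_def by (auto split: prod.splits)
  have "explored f x ([x], [])" by (simp add: explored_def)
  from explored_explore[OF this, of 8] have "explored f x ([], seen)" unfolding seen(1) .
  then show ?thesis
    using seen(2) unfolding explored_def list_all_iff by (intro exI[of _ "set seen"]) simp
qed

text \<open>The jointly reachable pairs of item lists and states form a bisimulation, so the
  transition table is verified without being derived.\<close>

lemma bad_items_check:
  "closure_check (\<lambda>(I, q). item_accepting I = accepting q)
     (\<lambda>(I, q). map (\<lambda>a. (item_step a I, delta q a)) [0, 1, 2]) (bad_items, Q0)"
  by code_simp

lemma accepting_run_iff:
  assumes "set w \<subseteq> {0, 1, 2}"
  shows "accepting (run Q0 w) \<longleftrightarrow>
    w \<in> typeI \<union> typeII \<union> typeIII \<union> typeIV \<union> typeV \<union> typeVI \<union> typeVII \<union> typeVIII"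
proof -
  obtain R where init: "(bad_items, Q0) \<in> R"
    and R: "\<forall>x\<in>R. (\<lambda>(I, q). item_accepting I = accepting q) x \<and>
      set ((\<lambda>(I, q). map (\<lambda>a. (item_step a I, delta q a)) [0, 1, 2]) x) \<subseteq> R"
    using closure_check[OF bad_items_check] by (elim exE conjE)
  have inv: "item_accepting I = accepting q" if "(I, q) \<in> R" for I q
    using bspec[OF R that] by simp
  have step: "(item_step a I, delta q a) \<in> R" if "(I, q) \<in> R" "a \<in> {0, 1, 2}" for I q a
    using bspec[OF R that(1)] that(2) by auto
  have "w \<in> item_lang I \<longleftrightarrow> accepting (run q w)" if "(I, q) \<in> R" for I q
    using that assms
  proof (induction w arbitrary: I q)
    case Nil
    then show ?case using inv by (simp add: Nil_in_item_lang)
  next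
    case (Cons a w)
    then show ?case using step[of I q a] by (simp add: Cons_in_item_lang)
  qed
  from this[of bad_items Q0] init show ?thesis unfolding item_lang_bad_items by simp
qed

section \<open>Children and insertions for the regular types\<close>

text \<open>This justifies pruning the explorations below wherever a state becomes
  \<open>Q4\<close>.\<close>

lemma accepting_sink: "\<not> accepting (run Q4 v)"
proof (induction v)
  case (Cons a v)
  have "delta Q4 a = Q4" by (simp add: delta_def split: nat.split)
  with Cons show ?case by simp
qed (simp add: accepting_def)

definition states :: "state list" where
  "states = [Q0, Q1, Q2, Q3, Q4, Q5, Q6, Q7, Q8, Q9, Q10, Q11, Q12, Q13, Q14, Q15,
    Q16, Q17, Q18, Q19, Q20, Q21, Q22, Q23, Q24, Q25, Q26, Q27, Q28, Q29, Q30, Q31]"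

lemma in_states: "q \<in> set states"
  by (cases q) (simp_all add: states_def)

text \<open>Pairs of words with the same action on the states. They suffice to keep bounded the word
  that represents the action of a reversed prefix.\<close>

definition rules :: "(nat list \<times> nat list) list" where
  "rules =
    [([2, 0, 2, 0], [2, 0]), ([0, 1, 0, 1, 0], [0, 1, 0]),
     ([0, 2, 0, 1, 0], [0, 1, 0, 2, 0]), ([0, 2, 1, 2, 0], [1, 2, 0, 2, 1]),
     ([1, 2, 1, 2, 0], [1, 2, 0, 2, 1]), ([1, 2, 1, 2, 1], [1, 2, 1]),
     ([2, 0, 1, 0, 2, 0], [2, 0, 1, 0]), ([2, 1, 2, 0, 2, 1], [2, 1, 2, 0])]"

text \<open>The stored words grow by one letter at the front, so only prefixes are matched, and at
  most one rule is applied each time.\<close>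

fun reduce_by :: "(nat list \<times> nat list) list \<Rightarrow> nat list \<Rightarrow> nat list" where
  "reduce_by [] u = u"
| "reduce_by ((l, r) # rs) u =
    (if take (length l) u = l then r @ drop (length l) u else reduce_by rs u)"

definition reduce :: "nat list \<Rightarrow> nat list" where
  "reduce = reduce_by rules"

lemma rules_check: "list_all (\<lambda>(l, r). list_all (\<lambda>q. run q l = run q r) states) rules"
  by code_simp

lemma run_reduce: "run q (reduce u) = run q u"
proof -
  have "run q (reduce_by rs u) = run q u"
    if "list_all (\<lambda>(l, r). list_all (\<lambda>q. run q l = run q r) states) rs" for rs
    using that
  proof (induction rs)
    case (Cons lr rs)
    obtain l r where lr: "lr = (l, r)" by (cases lr)
    have eq: "run q l = run q r" using Cons.prems lr in_states[of q] by (simp add: list_all_iff)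
    show ?case
    proof (cases "take (length l) u = l")
      case True
      have "run q u = run (run q l) (drop (length l) u)"
        by (metis True append_take_drop_id foldl_append)
      then show ?thesis using True by (simp add: lr eq)
    qed (use Cons in \<open>simp add: lr\<close>)
  qed simp
  then show ?thesis using rules_check by (simp add: reduce_def)
qed

text \<open>A parent \<open>a # w @ a # v\<close> and its child are read in parallel. In
  \<open>Pre p u\<close>, \<open>p\<close> is the state of the parent and \<open>u\<close> acts like
  the reversal of the part of \<open>w\<close> read so far; in \<open>Post p q\<close> the second
  \<open>a\<close> is passed and \<open>p\<close>, \<open>q\<close> are the states of parent and
  child.\<close>

datatype config = Pre state "nat list" | Post state state

text \<open>At every further \<open>a\<close> the search branches: it may be the one that the flip
  merges, or still belong to \<open>w\<close>. Branches on which the parent is already rejected are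
  dropped.\<close>

fun child_step :: "nat \<Rightarrow> config \<Rightarrow> config list" where
  "child_step a (Pre p u) = concat (map (\<lambda>c.
     if delta p c = Q4 then []
     else Pre (delta p c) (reduce (c # u)) #
       (if c = a then [Post (delta p c) (delta (run Q0 u) c)] else [])) [0, 1, 2])"
| "child_step a (Post p q) = concat (map (\<lambda>c.
     if delta p c = Q4 then [] else [Post (delta p c) (delta q c)]) [0, 1, 2])"

fun child_inv :: "config \<Rightarrow> bool" where
  "child_inv (Pre p u) = True"
| "child_inv (Post p q) = (accepting p \<longrightarrow> accepting q)"

lemma child_check:
  "list_all (\<lambda>a. closure_check child_inv (child_step a) (Pre (delta Q0 a) [])) [0, 1, 2]"
  by code_simp

text \<open>The exploration meets no \<open>Post\<close> pair with an accepted parent and a rejected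
  child. The proof follows \<open>w\<close> through \<open>Pre\<close> configurations and then
  \<open>v\<close> through \<open>Post\<close> pairs.\<close>

lemma accepting_child:
  assumes "accepting (run Q0 (a # w @ a # v))" and "set (a # w @ a # v) \<subseteq> {0, 1, 2}"
  shows "accepting (run Q0 (rev w @ a # v))"
proof -
  have "a \<in> set [0, 1, 2]" using assms(2) by simp
  from closure_check[OF bspec[OF child_check[unfolded list_all_iff] this]]
  obtain R where init: "Pre (delta Q0 a) [] \<in> R"
    and R: "\<forall>x\<in>R. child_inv x \<and> set (child_step a x) \<subseteq> R" by (elim exE conjE)
  have post: "accepting (run q v)"
    if "Post p q \<in> R" "accepting (run p v)" "set v \<subseteq> {0, 1, 2}" for p q v
    using that
  proof (induction v arbitrary: p q)
    case Nil
    then show ?case using bspec[OF R Nil(1)] by simp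
  next
    case (Cons c v)
    from Cons.prems have "delta p c \<noteq> Q4" using accepting_sink by auto
    then have "Post (delta p c) (delta q c) \<in> R"
      using bspec[OF R Cons.prems(1)] Cons.prems(3) by auto
    with Cons show ?case by simp
  qed
  \<comment> \<open>Generalized to the unread part of \<open>w\<close>, with \<open>u\<close>
    standing for the reversal of the part already read.\<close>
  have "accepting (run Q0 (rev w @ u @ a # v))"
    if "Pre p u \<in> R" "accepting (run p (w @ a # v))" "set (w @ a # v) \<subseteq> {0, 1, 2}" for p u w
    using that
  proof (induction w arbitrary: p u)
    case Nil
    then have "delta p a \<noteq> Q4" using accepting_sink by auto
    then have "Post (delta p a) (delta (run Q0 u) a) \<in> R"
      using bspec[OF R Nil(1)] Nil(3) by auto
    with Nil show ?case using post by simp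
  next
    case (Cons c w)
    from Cons.prems(2) have "delta p c \<noteq> Q4" using accepting_sink[of "w @ a # v"] by auto
    then have "Pre (delta p c) (reduce (c # u)) \<in> R"
      using bspec[OF R Cons.prems(1)] Cons.prems(3) by auto
    from Cons.IH[OF this] Cons.prems show ?case by (simp add: run_reduce)
  qed
  from this[OF init, of w] assms show ?thesis by simp
qed

text \<open>Here \<open>k\<close> is the number of symbols read, capped at 9, \<open>l\<close> the
  last one, \<open>p\<close> the state of the parent, \<open>u\<close> the reversed prefix, and
  \<open>qs\<close> the states of at most two children. Once two children are followed,
  \<open>u\<close> is discarded to keep the search small. A branch stops at a repeated symbol or
  when some child is certain to be rejected.\<close>

fun two_step :: "nat \<Rightarrow> nat \<times> nat \<times> state \<times> nat list \<times> state list
    \<Rightarrow> (nat \<times> nat \<times> state \<times> nat list \<times> state list) list" where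
  "two_step a (k, l, p, u, qs) = concat (map (\<lambda>c.
     let qs' = map (\<lambda>q. delta q c) qs @
       (if c = a \<and> length qs < 2 then [delta (run Q0 u) c] else [])
     in if c = l \<or> Q4 \<in> set qs' then []
        else [(min (Suc k) 9, c, delta p c, if length qs' < 2 then reduce (c # u) else [], qs')])
     [0, 1, 2])"

fun two_inv :: "nat \<times> nat \<times> state \<times> nat list \<times> state list \<Rightarrow> bool" where
  "two_inv (k, l, p, u, qs) =
     (k < 9 \<or> l \<noteq> 2 \<or> accepting p \<or> list_ex (\<lambda>q. \<not> accepting q) qs)"

lemma two_check:
  "list_all (\<lambda>a. closure_check two_inv (two_step a) (1, a, delta Q0 a, [], [])) [0, 1, 2]"
  by code_simp

text \<open>It suffices to try the first two occurrences of the first letter.\<close>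

lemma not_accepting_child:
  assumes "\<not> accepting (run Q0 s)" and "set s \<subseteq> {0, 1, 2}" and "normalized s" and "last s = 2"
    and "9 \<le> length s"
  shows "\<exists>a w v. s = a # w @ a # v \<and> \<not> accepting (run Q0 (rev w @ a # v))"
proof -
  obtain a s' where s: "s = a # s'" using assms(5) by (cases s) auto
  then have "a \<in> set [0, 1, 2]" using assms(2) by simp
  from closure_check[OF bspec[OF two_check[unfolded list_all_iff] this]]
  obtain R where init: "(1, a, delta Q0 a, [], []) \<in> R"
    and R: "\<forall>x\<in>R. two_inv x \<and> set (two_step a x) \<subseteq> R" by (elim exE conjE)
  \<comment> \<open>Either a child already being followed is rejected, or there is still room to
    follow another and a later \<open>a\<close> yields a rejected one.\<close>
  have main: "(\<exists>q\<in>set qs. \<not> accepting (run q v)) \<or>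
      (length qs < 2 \<and> (\<exists>w v'. v = w @ a # v' \<and> \<not> accepting (run Q0 (rev w @ u @ a # v'))))"
    if "(k, l, p, u, qs) \<in> R" "\<not> accepting (run p v)" "set v \<subseteq> {0, 1, 2}"
      "normalized (l # v)" "last (l # v) = 2" "9 \<le> k + length v" for k l p u qs v
    using that
  proof (induction v arbitrary: k l p u qs)
    case Nil
    then show ?case using bspec[OF R Nil(1)] by (auto simp: list_ex_iff)
  next
    case (Cons c v)
    define qs' where
      "qs' = map (\<lambda>q. delta q c) qs @ (if c = a \<and> length qs < 2 then [delta (run Q0 u) c] else [])"
    have found: ?case if "\<exists>q\<in>set qs'. \<not> accepting (run q v)"
    proof -
      from that consider q where "q \<in> set qs" "\<not> accepting (run (delta q c) v)"
        | "c = a" "length qs < 2" "\<not> accepting (run (delta (run Q0 u) c) v)"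
        by (auto simp: qs'_def split: if_splits)
      then show ?case
      proof cases
        case 1
        then show ?thesis by auto
      next
        case 2
        then have "c # v = [] @ a # v \<and> \<not> accepting (run Q0 (rev [] @ u @ a # v))" by simp
        with 2(2) show ?thesis by blast
      qed
    qed
    show ?case
    proof (cases "Q4 \<in> set qs'")
      case True
      then show ?thesis using found accepting_sink by blast
    next
      case False
      define u' where "u' = (if length qs' < 2 then reduce (c # u) else [])"
      have "c \<noteq> l" using Cons.prems(4) by (auto simp: normalized_def)
      with False have "(min (Suc k) 9, c, delta p c, u', qs') \<in> R"
        using bspec[OF R Cons.prems(1)] Cons.prems(3) by (auto simp: qs'_def u'_def Let_def)
      moreover have "normalized (c # v)" "last (c # v) = 2" "9 \<le> min (Suc k) 9 + length v"
        using Cons.prems(4-6) by (auto simp: normalized_def)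
      ultimately have "(\<exists>q\<in>set qs'. \<not> accepting (run q v)) \<or> (length qs' < 2 \<and>
          (\<exists>w v'. v = w @ a # v' \<and> \<not> accepting (run Q0 (rev w @ u' @ a # v'))))"
        using Cons.IH[of "min (Suc k) 9" c "delta p c" u' qs'] Cons.prems(2,3) by auto
      then show ?thesis
      proof
        assume "length qs' < 2 \<and>
          (\<exists>w v'. v = w @ a # v' \<and> \<not> accepting (run Q0 (rev w @ u' @ a # v')))"
        then obtain w v' where *: "length qs' < 2" "v = w @ a # v'"
          "\<not> accepting (run Q0 (rev w @ u' @ a # v'))" by blast
        from *(1) have "length qs < 2" by (simp add: qs'_def split: if_splits)
        moreover have "c # v = (c # w) @ a # v' \<and>
            \<not> accepting (run Q0 (rev (c # w) @ u @ a # v'))"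
          using * by (simp add: u'_def run_reduce)
        ultimately show ?thesis by blast
      qed (rule found)
    qed
  qed
  from main[OF init, of s'] assms show ?thesis
    by (auto simp: s)
qed

text \<open>The three states read the same suffix after \<open>ab\<close>, \<open>cab\<close> and
  \<open>acb\<close>; \<open>k\<close> is the length of the original word, capped at 5. A branch
  stops as soon as one of the three words is certain to be rejected.\<close>

fun insert_step :: "nat \<times> state \<times> state \<times> state \<Rightarrow> (nat \<times> state \<times> state \<times> state) list" where
  "insert_step (k, p, q, r) = concat (map (\<lambda>c.
     if delta p c = Q4 \<or> delta q c = Q4 \<or> delta r c = Q4 then []
     else [(min (Suc k) 5, delta p c, delta q c, delta r c)]) [0, 1, 2])"

fun insert_inv :: "nat \<times> state \<times> state \<times> state \<Rightarrow> bool" where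
  "insert_inv (k, p, q, r) = (k < 5 \<or> \<not> accepting p \<or> \<not> accepting q \<or> \<not> accepting r)"

lemma insert_check:
  "list_all (\<lambda>(a, b, c). closure_check insert_inv insert_step
     (2, run Q0 [a, b], run Q0 [c, a, b], run Q0 [a, c, b]))
     [(0, 1, 2), (0, 2, 1), (1, 0, 2), (1, 2, 0), (2, 0, 1), (2, 1, 0)]"
  by code_simp

text \<open>As \<open>c\<close> is the third symbol, both insertions respect normalization. From
  total length 5 on, the exploration finds no suffix for which all three words are accepted.\<close>

lemma accepting_insert:
  assumes "accepting (run Q0 (a # b # u))" and "set u \<subseteq> {0, 1, 2}" and "3 \<le> length u"
    and "{a, b, c} = {0, 1, 2}"
  shows "\<not> accepting (run Q0 (c # a # b # u)) \<or> \<not> accepting (run Q0 (a # c # b # u))"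
proof -
  have "a \<in> {0, 1, 2}" "b \<in> {0, 1, 2}" "c \<in> {0, 1, 2}" using assms(4) by blast+
  moreover have "a \<noteq> b" "a \<noteq> c" "b \<noteq> c"
  proof -
    have "card {a, b, c} = 3" unfolding assms(4) by simp
    then show "a \<noteq> b" "a \<noteq> c" "b \<noteq> c" by (auto simp: card_insert_if split: if_splits)
  qed
  ultimately have "(a, b, c) \<in>
      set [(0, 1, 2), (0, 2, 1), (1, 0, 2), (1, 2, 0), (2, 0, 1), (2, 1, 0)]" by auto
  from bspec[OF insert_check[unfolded list_all_iff] this]
  have "closure_check insert_inv insert_step
      (2, run Q0 [a, b], run Q0 [c, a, b], run Q0 [a, c, b])" by (simp only: prod.case)
  from closure_check[OF this]
  obtain R where init: "(2, run Q0 [a, b], run Q0 [c, a, b], run Q0 [a, c, b]) \<in> R"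
    and R: "\<forall>x\<in>R. insert_inv x \<and> set (insert_step x) \<subseteq> R" by (elim exE conjE)
  have main: "\<not> accepting (run q v) \<or> \<not> accepting (run r v)"
    if "(k, p, q, r) \<in> R" "accepting (run p v)" "set v \<subseteq> {0, 1, 2}" "5 \<le> k + length v" for k p q r v
    using that
  proof (induction v arbitrary: k p q r)
    case Nil
    then show ?case using bspec[OF R Nil(1)] by simp
  next
    case (Cons x v)
    show ?case
    proof (cases "delta q x = Q4 \<or> delta r x = Q4")
      case True
      then show ?thesis using accepting_sink by auto
    next
      case False
      moreover from Cons.prems have "delta p x \<noteq> Q4" using accepting_sink by auto
      ultimately have "(min (Suc k) 5, delta p x, delta q x, delta r x) \<in> R"
        using bspec[OF R Cons.prems(1)] Cons.prems(3) by auto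
      from Cons.IH[OF this] Cons.prems show ?thesis by simp
    qed
  qed
  from main[OF init, of u] assms show ?thesis by simp
qed

section \<open>Type IX and short strings\<close>

text \<open>The executable form of \<open>bad\<close>, valid for words over 0, 1, 2.\<close>

definition is_bad :: "nat list \<Rightarrow> bool" where
  "is_bad s \<longleftrightarrow> accepting (run Q0 s) \<or> s \<in> typeIX"

lemma bad_iff: "set s \<subseteq> {0, 1, 2} \<Longrightarrow> bad s \<longleftrightarrow> is_bad s"
  by (simp only: is_bad_def bad_def accepting_run_iff Un_iff)

primrec children_from :: "nat \<Rightarrow> nat list \<Rightarrow> nat list \<Rightarrow> nat list list" where
  "children_from a y [] = []"
| "children_from a y (c # v) = (if c = a then [y @ c # v] else []) @ children_from a (c # y) v"

fun children :: "nat list \<Rightarrow> nat list list" where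
  "children [] = []"
| "children (a # s) = children_from a [] s"

text \<open>The inverse of passing to a child: each symbol in turn is taken as the merged one, the
  part before it is reversed, and a copy is put in front.\<close>

primrec parents_from :: "nat list \<Rightarrow> nat list \<Rightarrow> nat list list" where
  "parents_from y [] = []"
| "parents_from y (a # v) = (a # y @ a # v) # parents_from (a # y) v"

text \<open>The empty base case excludes insertion after the last symbol, so a final 2 is
  kept.\<close>

fun insertions :: "nat list \<Rightarrow> nat list list" where
  "insertions [] = []"
| "insertions (a # s) = map (\<lambda>x. x # a # s) [0, 1, 2] @ map ((#) a) (insertions s)"

text \<open>The normalized words over 0, 1, 2 of a given positive length that end in 2, grown
  leftwards from the final symbol.\<close>

fun words :: "nat \<Rightarrow> nat list list" where
  "words 0 = []"
| "words (Suc 0) = [[2]]"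
| "words (Suc n) = concat (map (\<lambda>w. concat (map (\<lambda>a. if a = hd w then [] else [a # w]) [0, 1, 2])) (words n))"

lemma children_from: "w @ a # v = s \<Longrightarrow> rev w @ y @ a # v \<in> set (children_from a y s)"
proof (induction s arbitrary: w y)
  case (Cons c s)
  show ?case
  proof (cases w)
    case (Cons d w')
    then have "w' @ a # v = s" using Cons.prems by simp
    from Cons.IH[OF this, of "c # y"] show ?thesis using Cons Cons.prems by simp
  qed (use Cons.prems in simp)
qed simp

lemma children_fromE:
  assumes "t \<in> set (children_from a y s)"
  shows "\<exists>w v. s = w @ a # v \<and> t = rev w @ y @ a # v"
  using assms
proof (induction s arbitrary: y)
  case (Cons c s)
  from Cons.prems consider "c = a" "t = y @ c # s" | "t \<in> set (children_from a (c # y) s)"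
    by (auto split: if_splits)
  then show ?case
  proof cases
    case 1
    then have "c # s = [] @ a # s \<and> t = rev [] @ y @ a # s" by simp
    then show ?thesis by blast
  next
    case 2
    then obtain w v where "s = w @ a # v" "t = rev w @ (c # y) @ a # v" using Cons.IH by blast
    then have "c # s = (c # w) @ a # v \<and> t = rev (c # w) @ y @ a # v" by simp
    then show ?thesis by blast
  qed
qed simp

lemma in_children: "rev w @ a # v \<in> set (children (a # w @ a # v))"
  using children_from[of w a v "w @ a # v" "[]"] by simp

lemma in_childrenE:
  assumes "t \<in> set (children s)"
  shows "\<exists>a w v. s = a # w @ a # v \<and> t = rev w @ a # v"
proof (cases s)
  case (Cons a r)
  then obtain w v where "r = w @ a # v" "t = rev w @ a # v"
    using children_fromE[of t a "[]" r] assms by auto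
  then show ?thesis using Cons by blast
qed (use assms in simp)

lemma parents_from: "a # rev x @ y @ a # v \<in> set (parents_from y (x @ a # v))"
proof (induction x arbitrary: y)
  case (Cons c x)
  show ?case using Cons[of "c # y"] by simp
qed simp

lemma in_parents: "a # w @ a # v \<in> set (parents_from [] (rev w @ a # v))"
  using parents_from[of a "rev w" "[]" v] by simp

lemma insertions:
  assumes "t \<in> set (insertions s)"
  shows "subseq s t \<and> length t = Suc (length s) \<and> last t = last s
    \<and> set s \<subseteq> set t \<and> set t \<subseteq> set s \<union> {0, 1, 2}"
  using assms
proof (induction s arbitrary: t)
  case (Cons a s)
  from Cons.prems consider x where "t = x # a # s" "x \<in> {0, 1, 2}"
    | u where "t = a # u" "u \<in> set (insertions s)" by auto
  then show ?case
  proof cases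
    case 1
    then show ?thesis by auto
  next
    case 2
    then have "s \<noteq> []" "u \<noteq> []" using Cons.IH[OF 2(2)] by auto
    then show ?thesis using 2(1) Cons.IH[OF 2(2)] by auto
  qed
qed simp

lemma in_set_concat_map: "x \<in> set xs \<Longrightarrow> y \<in> set (f x) \<Longrightarrow> y \<in> set (concat (map f xs))"
  by auto

lemma in_words:
  assumes "s \<noteq> []" "normalized s" "last s = 2" "set s \<subseteq> {0, 1, 2}"
  shows "s \<in> set (words (length s))"
  using assms
proof (induction s)
  case (Cons a s)
  show ?case
  proof (cases s)
    case Nil
    then show ?thesis using Cons.prems by simp
  next
    case c: (Cons b s')
    have "s \<noteq> []" "normalized s" "last s = 2" "set s \<subseteq> {0, 1, 2}"
      using Cons.prems by (simp_all add: c normalized_def)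
    then have s: "s \<in> set (words (length s))" by (rule Cons.IH)
    have a: "a \<noteq> hd s" "a \<in> set [0, 1, 2]"
      using Cons.prems by (simp_all add: c normalized_def)
    have words: "words (length (a # s)) = concat (map (\<lambda>w. concat (map
        (\<lambda>a. if a = hd w then [] else [a # w]) [0, 1, 2])) (words (length s)))"
      by (simp add: c)
    show ?thesis
      unfolding words by (intro in_set_concat_map[OF s] in_set_concat_map[OF a(2)]) (simp add: a(1))
  qed
qed simp

lemma typeIX_children_check: "\<forall>t\<in>typeIX. list_all is_bad (children t)"
  by code_simp

definition has_good_child :: "nat list \<Rightarrow> bool" where
  "has_good_child s \<longleftrightarrow> list_ex (\<lambda>t. \<not> is_bad t) (children s)"

text \<open>A child rejected by the automaton may still be of type IX and hence bad. All parents of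
  the 77 strings are therefore inspected for another, good child.\<close>

lemma typeIX_parents_check:
  "\<forall>t\<in>typeIX. list_all (\<lambda>s. length s < 9 \<or> \<not> normalized s \<or> is_bad s \<or> has_good_child s) (parents_from [] t)"
  by code_simp

text \<open>These are the lengths below the threshold 9 of
  \<open>not_accepting_child\<close>.\<close>

lemma short_check:
  "list_all (\<lambda>n. list_all (\<lambda>s. is_bad s \<or> has_good_child s) (words n)) [4, 5, 6, 7, 8]"
  by code_simp

definition has_good_insertion :: "nat list \<Rightarrow> bool" where
  "has_good_insertion s \<longleftrightarrow>
     is_bad s \<and> s \<noteq> [0, 2, 1, 2] \<and> {0, 1, 2} \<subseteq> set s \<longrightarrow>
     list_ex (\<lambda>t. normalized t \<and> \<not> is_bad t) (insertions s)"

text \<open>These are the cases outside \<open>accepting_insert\<close>: lengths below 5, strings of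
  type IX, and strings for which one of the two insertions lands in type IX. The last are recovered
  by deleting the first or second symbol of a type IX string.\<close>

lemma insertion_check:
  "list_all has_good_insertion (words 3 @ words 4)"
  "\<forall>t\<in>typeIX. list_all has_good_insertion [t, tl t, hd t # tl (tl t)]"
  by code_simp+

section \<open>Children and insertions for all types together\<close>

lemma bad_child:
  assumes "bad (a # w @ a # v)" and "set (a # w @ a # v) \<subseteq> {0, 1, 2}"
  shows "bad (rev w @ a # v)"
proof -
  have "is_bad (a # w @ a # v)" using assms bad_iff by blast
  then have "is_bad (rev w @ a # v)"
    unfolding is_bad_def[of "a # w @ a # v"]
  proof
    assume "accepting (run Q0 (a # w @ a # v))"
    then show ?thesis unfolding is_bad_def using accepting_child assms(2) by blast
  next
    assume "a # w @ a # v \<in> typeIX"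
    then show ?thesis
      using typeIX_children_check in_children[of w a v] unfolding list_all_iff by blast
  qed
  moreover have "set (rev w @ a # v) \<subseteq> {0, 1, 2}" using assms(2) by simp
  ultimately show ?thesis using bad_iff by blast
qed

lemma good_child:
  assumes "\<not> bad s" "normalized s" "last s = 2" "set s = {0, 1, 2}" "4 \<le> length s"
  shows "\<exists>a w v. s = a # w @ a # v \<and> \<not> bad (rev w @ a # v)"
proof -
  have s: "\<not> is_bad s" using assms bad_iff by simp
  have "\<exists>a w v. s = a # w @ a # v \<and> \<not> is_bad (rev w @ a # v)"
  proof (cases "has_good_child s")
    case True
    then obtain t where t: "t \<in> set (children s)" "\<not> is_bad t"
      unfolding has_good_child_def list_ex_iff by blast
    from in_childrenE[OF t(1)] t(2) show ?thesis by blast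
  next
    case nochild: False
    have long: "9 \<le> length s"
    proof (rule ccontr)
      assume "\<not> 9 \<le> length s"
      then have len: "length s \<in> set [4, 5, 6, 7, 8]" using assms(5) by auto
      have "s \<noteq> []" using assms(4) by auto
      then have "s \<in> set (words (length s))" using assms(2-4) by (intro in_words) simp_all
      from bspec[OF bspec[OF short_check[unfolded list_all_iff] len] this]
      have "is_bad s \<or> has_good_child s" .
      with s nochild show False by blast
    qed
    have "\<not> accepting (run Q0 s)" "set s \<subseteq> {0, 1, 2}" using s assms(4) by (simp_all add: is_bad_def)
    from not_accepting_child[OF this assms(2,3) long] obtain a w v
      where *: "s = a # w @ a # v" "\<not> accepting (run Q0 (rev w @ a # v))" by blast
    \<comment> \<open>Otherwise \<open>s\<close> would be one of the inspected parents and would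
      have a good child.\<close>
    have "rev w @ a # v \<notin> typeIX"
    proof
      assume "rev w @ a # v \<in> typeIX"
      from bspec[OF bspec[OF typeIX_parents_check this, unfolded list_all_iff] in_parents]
      have "length s < 9 \<or> \<not> normalized s \<or> is_bad s \<or> has_good_child s" unfolding *(1) .
      with s nochild assms long show False by simp
    qed
    with * show ?thesis unfolding is_bad_def by blast
  qed
  then obtain a w v where *: "s = a # w @ a # v" "\<not> is_bad (rev w @ a # v)" by blast
  then have "set (rev w @ a # v) \<subseteq> {0, 1, 2}" using assms(4) by auto
  with * bad_iff show ?thesis by blast
qed

lemma bad_insertion:
  assumes "bad s" "normalized s" "last s = 2" "set s = {0, 1, 2}" "s \<noteq> [0, 2, 1, 2]"
  shows "\<exists>t. subseq s t \<and> length t = Suc (length s) \<and> normalized t \<and> last t = 2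
    \<and> set t = {0, 1, 2} \<and> \<not> bad t"
proof -
  have s: "is_bad s" using assms bad_iff by simp
  have "\<exists>t\<in>set (insertions s). normalized t \<and> \<not> is_bad t"
  proof (rule ccontr)
    assume none: "\<not> ?thesis"
    then have no: "\<not> has_good_insertion s"
      using s assms by (simp add: has_good_insertion_def list_ex_iff)
    have long: "5 \<le> length s"
    proof (rule ccontr)
      assume "\<not> 5 \<le> length s"
      moreover have "3 \<le> length s"
        using card_length[of s] assms(4) by simp
      ultimately have "length s = 3 \<or> length s = 4" by linarith
      moreover have "s \<noteq> []" using assms(4) by auto
      then have "s \<in> set (words (length s))" using assms(2-4) by (intro in_words) simp_all
      ultimately have "s \<in> set (words 3 @ words 4)" unfolding set_append by auto
      from bspec[OF insertion_check(1)[unfolded list_all_iff] this]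
      have "has_good_insertion s" .
      with no show False by blast
    qed
    have ix: "has_good_insertion t" "has_good_insertion (tl t)" "has_good_insertion (hd t # tl (tl t))"
      if "t \<in> typeIX" for t using bspec[OF insertion_check(2) that] by simp_all
    \<comment> \<open>Type IX is settled by enumeration, so \<open>s\<close> is bad through the
      automaton.\<close>
    have acc: "accepting (run Q0 s)" using s no ix(1) unfolding is_bad_def by blast
    from long obtain a b u where u: "s = a # b # u"
      by (auto simp: numeral_eq_Suc Suc_le_length_iff)
    have "a \<in> set s" "b \<in> set s" by (simp_all add: u)
    then have "a \<in> {0, 1, 2}" "b \<in> {0, 1, 2}" unfolding assms(4) .
    have "a \<noteq> b" using assms(2) by (simp add: u normalized_def)
    \<comment> \<open>The remaining symbol, because 0, 1 and 2 sum to 3.\<close>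
    define c where "c = 3 - a - b"
    have c: "{a, b, c} = {0, 1, 2}" "c \<noteq> a" "c \<noteq> b" "c \<in> {0, 1, 2}"
      using \<open>a \<noteq> b\<close> \<open>a \<in> {0, 1, 2}\<close> \<open>b \<in> {0, 1, 2}\<close> unfolding c_def by auto
    have norm: "normalized (c # a # b # u)" "normalized (a # c # b # u)"
      using assms(2) c(2,3) unfolding u by (simp_all add: normalized_def)
    have ins: "c # a # b # u \<in> set (insertions s)" "a # c # b # u \<in> set (insertions s)"
      using c(4) unfolding u by auto
    have "is_bad (c # a # b # u)" "is_bad (a # c # b # u)"
      using none norm ins by blast+
    moreover have "c # a # b # u \<notin> typeIX"
    proof
      assume "c # a # b # u \<in> typeIX"
      from ix(2)[OF this] no show False by (simp add: u)
    qed
    moreover have "a # c # b # u \<notin> typeIX"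
    proof
      assume "a # c # b # u \<in> typeIX"
      from ix(3)[OF this] no show False by (simp add: u)
    qed
    ultimately have "accepting (run Q0 (c # a # b # u))" "accepting (run Q0 (a # c # b # u))"
      unfolding is_bad_def by blast+
    moreover have "set u \<subseteq> set s" by (auto simp: u)
    then have "set u \<subseteq> {0, 1, 2}" unfolding assms(4) .
    moreover have "3 \<le> length u" using long by (simp add: u)
    moreover have "accepting (run Q0 (a # b # u))" using acc unfolding u .
    ultimately show False using accepting_insert[of a b u c] c(1) by blast
  qed
  then obtain t where t: "t \<in> set (insertions s)" "normalized t" "\<not> is_bad t" by blast
  note ins = insertions[OF t(1)]
  have "set t = {0, 1, 2}" using ins unfolding assms(4) by (intro equalityI) simp_all
  moreover from this have "\<not> bad t" using bad_iff[of t] t(3) by simp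
  ultimately show ?thesis using t(2) ins assms(3) by (intro exI[of _ t]) simp
qed

section \<open>Sorting distance\<close>

lemma normalized_iff: "normalized s \<longleftrightarrow> remdups_adj s = s"
  unfolding normalized_def distinct_adj_def[symmetric] by (rule distinct_adj_altdef)

lemma normalized_remdups_adj: "normalized (remdups_adj s)"
  unfolding normalized_def distinct_adj_def[symmetric] by (rule distinct_adj_remdups_adj)

lemma normalized_append:
  "normalized (s @ t) \<longleftrightarrow> normalized s \<and> normalized t \<and> (s = [] \<or> t = [] \<or> last s \<noteq> hd t)"
  unfolding normalized_def successively_append_iff by blast

lemma normalized_rev: "normalized (rev s) \<longleftrightarrow> normalized s"
  by (simp add: normalized_iff)

lemma normalized_Cons: "normalized (a # s) \<longleftrightarrow> normalized s \<and> (s = [] \<or> a \<noteq> hd s)"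
  using normalized_append[of "[a]" s] by (simp add: normalized_def)

lemma normalized_flip: "normalized (flip i s)"
  by (simp add: flip_def normalization_def normalized_remdups_adj)

lemma set_flip: "set (flip i s) = set s"
proof -
  have "set (flip i s) = set (take i s) \<union> set (drop i s)"
    by (simp add: flip_def normalization_def)
  then show ?thesis unfolding set_append[symmetric] append_take_drop_id .
qed

text \<open>The flip of length 1 is idle. Idle flips let an induced flip sequence have exactly the
  length of the original one.\<close>

lemma flip_step_refl:
  assumes "normalized s" "s \<noteq> []"
  shows "flip_step s s"
proof -
  obtain a r where s: "s = a # r" using assms(2) by (cases s) simp_all
  have "flip 1 s = s"
    using assms(1) by (simp add: s flip_def normalization_def normalized_iff)
  then show ?thesis
    unfolding flip_step_def by (intro exI[of _ 1]) (simp add: s)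
qed

lemma flip_append:
  "flip (length u) (u @ v) = remdups_adj (rev u @ v)"
  by (simp add: flip_def normalization_def)

text \<open>Reversing \<open>a # w\<close> brings two copies of \<open>a\<close> together. No other
  adjacent symbols coincide, so exactly one symbol disappears.\<close>

lemma flip_child:
  assumes "normalized (a # w @ a # v)"
  shows "flip (Suc (length w)) (a # w @ a # v) = rev w @ a # v"
proof -
  have "normalized (a # w)" "normalized (a # v)"
    using assms normalized_append[of "a # w" "a # v"] by simp_all
  then have "normalized (rev w @ a # v)"
    by (auto simp: normalized_append normalized_rev normalized_Cons last_rev)
  then have "remdups_adj (rev w @ [a]) @ tl (remdups_adj (a # v)) = rev w @ a # v"
    by (simp add: normalized_iff remdups_adj_append[symmetric])
  moreover have "remdups_adj (rev w @ a # a # v) = remdups_adj (rev w @ [a]) @ tl (remdups_adj (a # v))"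
    by (simp add: remdups_adj_append[of "rev w" a "a # v"])
  moreover have "flip (Suc (length w)) (a # w @ a # v) = remdups_adj (rev w @ a # a # v)"
    using flip_append[of "a # w" "a # v"] by simp
  ultimately show ?thesis by simp
qed

lemma flip_step_child:
  assumes "normalized (a # w @ a # v)"
  shows "flip_step (a # w @ a # v) (rev w @ a # v)"
  unfolding flip_step_def using flip_child[OF assms]
  by (intro exI[of _ "Suc (length w)"]) simp

text \<open>An embedding of a normalized string uses at most one symbol of each maximal run, since
  two from the same run would be adjacent and equal.\<close>

lemma subseq_remdups_adj:
  assumes "subseq s t" "normalized s"
  shows "subseq s (remdups_adj t)"
  using assms
proof (induction t arbitrary: s rule: remdups_adj.induct)
  case (3 x y t)
  show ?case
  proof (cases s)
    case (Cons a s')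
    then have s': "normalized s'" "s' = [] \<or> a \<noteq> hd s'"
      using "3.prems"(2) by (simp_all add: normalized_Cons)
    show ?thesis
    proof (cases "x = y")
      case True
      have "subseq s (y # t)"
      proof (cases "a = y")
        case ay: True
        then have "subseq s' (y # t)" using "3.prems"(1) Cons True by simp
        then have "subseq s' t" using s'(2) ay by (cases s') (simp_all split: if_splits)
        then show ?thesis using Cons ay by simp
      qed (use "3.prems"(1) Cons True in simp)
      then have "subseq s (x # t)" using True by simp
      from "3.IH"(1)[OF True this "3.prems"(2)] show ?thesis using True by simp
    next
      case False
      note IH = "3.IH"(2)[OF False]
      show ?thesis
      proof (cases "a = x")
        case True
        then have "subseq s' (y # t)" using "3.prems"(1) Cons by simp
        from IH[OF this s'(1)] show ?thesis using Cons True False by simp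
      next
        case ax: False
        then have "subseq s (y # t)" using "3.prems"(1) Cons by simp
        from IH[OF this "3.prems"(2)] show ?thesis using Cons ax False by simp
      qed
    qed
  qed simp
qed simp_all

lemma subseq_remdups_adj_self: "subseq (remdups_adj s) s"
  by (induction s rule: remdups_adj.induct) auto

lemma subseq_rev: "subseq s t \<Longrightarrow> subseq (rev s) (rev t)"
  by (induction rule: list_emb.induct) (simp_all add: list_emb_append_mono subseq_rev_drop_many)

text \<open>The embedding splits at the flipped prefix of \<open>t\<close> into
  \<open>s = u @ v\<close>, and \<open>s\<close> is flipped after \<open>u\<close>. If
  \<open>u\<close> is empty, the idle flip is used instead.\<close>

lemma flip_step_subseq:
  assumes "flip_step t t'" "subseq s t" "normalized s" "s \<noteq> []"
  shows "\<exists>s'. flip_step s s' \<and> subseq s' t'"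
proof -
  obtain i where i: "i \<le> length t" "t' = flip i t"
    using assms(1) by (auto simp: flip_step_def)
  have t': "t' = remdups_adj (rev (take i t) @ drop i t)"
    using i(2) by (simp add: flip_def normalization_def)
  have "subseq s (take i t @ drop i t)" using assms(2) by simp
  then obtain u v where uv: "s = u @ v" "subseq u (take i t)" "subseq v (drop i t)"
    by (rule subseq_appendE)
  have sub: "subseq (rev u @ v) (rev (take i t) @ drop i t)"
    by (rule list_emb_append_mono[OF subseq_rev[OF uv(2)] uv(3)])
  show ?thesis
  proof (cases "u = []")
    case True
    then have "subseq s t'"
      unfolding t' using sub uv(1) assms(3) by (intro subseq_remdups_adj) simp_all
    then show ?thesis using flip_step_refl assms(3,4) by blast
  next
    case False
    have "subseq (remdups_adj (rev u @ v)) (rev (take i t) @ drop i t)"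
      by (rule subseq_order.trans[OF subseq_remdups_adj_self sub])
    then have "subseq (remdups_adj (rev u @ v)) t'"
      unfolding t' by (rule subseq_remdups_adj[OF _ normalized_remdups_adj])
    moreover have "flip_step s (remdups_adj (rev u @ v))"
      unfolding flip_step_def uv(1) using False
      by (intro exI[of _ "length u"]) (simp add: flip_append Suc_le_eq)
    ultimately show ?thesis by blast
  qed
qed

text \<open>Flips preserve the set of symbols, so the string that arrives as a subsequence of 012
  still has three symbols and equals 012.\<close>

lemma flip_steps_subseq:
  assumes "(flip_step ^^ k) t [0, 1, 2]" "subseq s t" "normalized s" "set s = {0, 1, 2}"
  shows "(flip_step ^^ k) s [0, 1, 2]"
  using assms
proof (induction k arbitrary: s t)
  case 0
  then have "subseq s [0, 1, 2]" by simp
  moreover have "length s \<ge> 3" using card_length[of s] 0(4) by simp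
  ultimately have "s = [0, 1, 2]"
    by (intro subseq_same_length) (auto dest: list_emb_length)
  then show ?case by simp
next
  case (Suc k)
  from Suc.prems(1) obtain t' where t': "flip_step t t'" "(flip_step ^^ k) t' [0, 1, 2]"
    by (rule relpowp_Suc_E2)
  have "s \<noteq> []" using Suc.prems(4) by auto
  then obtain s' where s': "flip_step s s'" "subseq s' t'"
    using flip_step_subseq[OF t'(1) Suc.prems(2,3)] by blast
  then have "normalized s'" "set s' = {0, 1, 2}"
    using Suc.prems(4) normalized_flip set_flip by (auto simp: flip_step_def)
  from Suc.IH[OF t'(2) s'(2) this] s'(1) show ?case by (rule relpowp_Suc_I2[rotated])
qed

section \<open>The claimed distance as a potential\<close>

lemma bad_short:
  "bad [1, 0, 2]" "bad [0, 2, 1, 2]" "bad [2, 0, 1, 2]" "bad [1, 2, 0, 2]" "\<not> bad [0, 1, 2]"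
  by (subst bad_iff, simp, code_simp)+

text \<open>The claimed distance of a string ending in 2, in one formula; 0212 is bad and so
  receives both increments.\<close>

definition weight :: "nat list \<Rightarrow> nat" where
  "weight s = length s - 3 + (if bad s then 1 else 0) + (if s = [0, 2, 1, 2] then 1 else 0)"

text \<open>Good strings lose one symbol per flip down to length 3. A bad string other than 0212
  follows the sequence of a good string one symbol longer, and 0212 is sorted explicitly.\<close>

lemma weight_upper:
  assumes "normalized s" "last s = 2" "set s = {0, 1, 2}"
  shows "(flip_step ^^ weight s) s [0, 1, 2]"
proof -
  have good: "(flip_step ^^ (length s - 3)) s [0, 1, 2]"
    if "normalized s" "last s = 2" "set s = {0, 1, 2}" "\<not> bad s" for s
    using that
  proof (induction "length s" arbitrary: s rule: less_induct)
    case less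
    have len: "3 \<le> length s" using card_length[of s] less.prems(3) by simp
    show ?case
    proof (cases "length s = 3")
      case True
      have "s \<noteq> []" using less.prems(3) by auto
      then have "s \<in> set (words 3)" using in_words[of s] less.prems(1-3) True by simp
      \<comment> \<open>Only 012 and 102 among these contain all three symbols, and 102 is
        bad.\<close>
      then have "s \<in> {[0, 1, 2], [1, 0, 2], [2, 0, 2], [2, 1, 2]}"
        by (auto simp: numeral_3_eq_3)
      moreover have "0 \<in> set s" "1 \<in> set s" unfolding less.prems(3) by simp_all
      ultimately have "s = [0, 1, 2]" using less.prems(4) bad_short(1) by auto
      then show ?thesis by simp
    next
      case False
      then have "4 \<le> length s" using len by simp
      from good_child[OF less.prems(4) less.prems(1-3) this]
      obtain a w v where s: "s = a # w @ a # v" "\<not> bad (rev w @ a # v)" by blast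
      let ?t = "rev w @ a # v"
      have step: "flip_step s ?t" using flip_step_child less.prems(1) unfolding s(1) .
      then have "normalized ?t" unfolding flip_step_def using normalized_flip by metis
      moreover have "set ?t = set s" unfolding s(1) by auto
      then have "set ?t = {0, 1, 2}" unfolding less.prems(3) .
      moreover have "last ?t = 2" using less.prems(2) by (simp add: s(1))
      ultimately have "(flip_step ^^ (length ?t - 3)) ?t [0, 1, 2]"
        using less.hyps[of ?t] s by simp
      with step have "(flip_step ^^ Suc (length ?t - 3)) s [0, 1, 2]" by (rule relpowp_Suc_I2)
      moreover have "Suc (length ?t - 3) = length s - 3" using s(1) len False by simp
      ultimately show ?thesis by (simp only:)
    qed
  qed
  consider "s = [0, 2, 1, 2]" | "s \<noteq> [0, 2, 1, 2]" "bad s" | "s \<noteq> [0, 2, 1, 2]" "\<not> bad s" by blast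
  then show ?thesis
  proof cases
    case 1
    \<comment> \<open>The route is 0212, 2012, 102, 012.\<close>
    have "flip_step [0, 2, 1, 2] (flip 2 [0, 2, 1, 2])"
      unfolding flip_step_def by (intro exI[of _ 2]) simp
    moreover have "flip_step [2, 0, 1, 2] (flip 3 [2, 0, 1, 2])"
      unfolding flip_step_def by (intro exI[of _ 3]) simp
    moreover have "flip_step [1, 0, 2] (flip 2 [1, 0, 2])"
      unfolding flip_step_def by (intro exI[of _ 2]) simp
    moreover have "flip 2 [0, 2, 1, 2] = [2, 0, 1, 2]" "flip 3 [2, 0, 1, 2] = [1, 0, 2]"
      "flip 2 [1, 0, 2] = [0, 1, 2]"
      by (simp_all add: flip_def normalization_def numeral_2_eq_2 numeral_3_eq_3)
    ultimately have "flip_step [0, 2, 1, 2] [2, 0, 1, 2]" "flip_step [2, 0, 1, 2] [1, 0, 2]"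
      "flip_step [1, 0, 2] [0, 1, 2]" by simp_all
    then have "(flip_step ^^ Suc (Suc (Suc 0))) [0, 2, 1, 2] [0, 1, 2]"
      by (intro relpowp_Suc_I2[of flip_step]) (assumption | simp)+
    moreover have "weight [0, 2, 1, 2] = Suc (Suc (Suc 0))"
      using bad_short(2) by (simp add: weight_def)
    ultimately show ?thesis unfolding 1 by simp
  next
    case 2
    from bad_insertion[OF 2(2) assms 2(1)] obtain t where t: "subseq s t"
      "length t = Suc (length s)" "normalized t" "last t = 2" "set t = {0, 1, 2}" "\<not> bad t"
      by blast
    have "3 \<le> length s" using card_length[of s] assms(3) by simp
    then have "weight s = length t - 3" using 2 t(2) by (simp add: weight_def)
    then show ?thesis
      using flip_steps_subseq[OF good[OF t(3-6)] t(1)] assms by simp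
  next
    case 3
    then show ?thesis using good[OF assms] by (simp add: weight_def)
  qed
qed

lemma weight_bounds: "length s - 3 \<le> weight s" "weight s \<le> length s - 3 + 2"
  by (simp_all add: weight_def)

text \<open>A flip may lose one symbol or the increment for badness; the last hypothesis excludes
  losing both at once.\<close>

lemma weight_le_Suc:
  assumes "s \<noteq> [0, 2, 1, 2]" "3 \<le> length t" "length s \<le> Suc (length t)"
    and "length s \<le> length t \<or> (bad s \<longrightarrow> bad t)"
  shows "weight s \<le> Suc (weight t)"
  using assms by (auto simp: weight_def)

text \<open>As \<open>i < length s\<close>, the final 2 stays in place. If the first symbol equals
  the one after the flipped prefix, the string shortens and \<open>bad_child\<close> preserves
  badness; otherwise the length is kept.\<close>

lemma weight_flip:
  assumes "normalized s" "last s = 2" "set s = {0, 1, 2}" "i < length s"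
  shows "weight s \<le> Suc (weight (flip i s))"
proof (cases "s = [0, 2, 1, 2]")
  case True
  \<comment> \<open>No flip within the first three symbols shortens 0212, and all results are bad,
    which pays for the second increment.\<close>
  have "bad [0, 2, 1, 2]" "bad [2, 0, 1, 2]" "bad [1, 2, 0, 2]"
    by (simp_all add: bad_iff) code_simp+
  moreover have "i \<in> {0, 1, 2, 3}" using assms(4) True by auto
  then have "flip i s \<in> {[0, 2, 1, 2], [2, 0, 1, 2], [1, 2, 0, 2]}"
    unfolding True by (auto simp: flip_def normalization_def numeral_2_eq_2 numeral_3_eq_3)
  ultimately show ?thesis unfolding True by (auto simp: weight_def)
next
  case other: False
  have len: "length (flip i s) \<ge> 3"
    using card_length[of "flip i s"] assms(3) by (simp add: set_flip)
  show ?thesis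
  proof (cases "i = 0")
    case True
    then have "flip i s = s" using assms(1) by (simp add: flip_def normalization_def normalized_iff)
    then show ?thesis by simp
  next
    case False
    then obtain a w where aw: "take i s = a # w" using assms(4) by (cases s; cases i) auto
    obtain b v where bv: "drop i s = b # v" using assms(4) by (cases "drop i s") auto
    have s: "s = a # w @ b # v" using aw bv append_take_drop_id[of i s] by simp
    have i: "i = Suc (length w)" using arg_cong[OF aw, of length] assms(4) by simp
    show ?thesis
    proof (cases "a = b")
      case True
      then have "flip i s = rev w @ a # v" using flip_child[of a w v] assms(1) by (simp add: s i)
      moreover have eq: "a # w @ a # v = s" by (simp add: s True)
      have "bad s \<Longrightarrow> bad (rev w @ a # v)"
        by (rule bad_child) (simp_all only: eq assms(3) subset_refl)
      ultimately show ?thesis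
        using len other by (intro weight_le_Suc) (simp_all, simp add: s)
    next
      case False
      have "normalized (a # w)" "normalized (b # v)"
        using assms(1) normalized_append[of "a # w" "b # v"] by (simp_all add: s)
      then have "normalized (rev (a # w) @ b # v)"
        using False normalized_rev[of "a # w"] normalized_append[of "rev (a # w)" "b # v"] by simp
      then have "flip i s = rev (a # w) @ b # v"
        using flip_append[of "a # w" "b # v"] by (simp add: s i normalized_iff)
      then have "length (flip i s) = length s" by (simp add: s)
      then show ?thesis using other len by (intro weight_le_Suc) simp_all
    qed
  qed
qed

text \<open>Words not ending in 2 are compared through the extension by a final 2.\<close>

definition extend :: "nat list \<Rightarrow> nat list" where
  "extend s = remdups_adj (s @ [2])"

lemma remdups_adj_remdups_adj_append: "remdups_adj (remdups_adj s @ t) = remdups_adj (s @ t)" for s :: "nat list"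
proof (cases "s = []")
  case False
  have "remdups_adj (remdups_adj s) = remdups_adj s"
    using normalized_remdups_adj[of s] unfolding normalized_iff .
  then show ?thesis using False by (simp add: remdups_adj_append'')
qed simp

lemma remdups_adj_snoc_last:
  assumes "s \<noteq> []"
  shows "remdups_adj (s @ [last s]) = remdups_adj s"
proof -
  have "remdups_adj (butlast s @ [last s, last s]) = remdups_adj (butlast s @ [last s])"
    by (simp only: remdups_adj_append_two) simp
  moreover have "butlast s @ [last s, last s] = (butlast s @ [last s]) @ [last s]" by simp
  ultimately show ?thesis by (simp only: append_butlast_last_id[OF assms])
qed

lemma extend_id:
  assumes "normalized s" "last s = 2" "s \<noteq> []"
  shows "extend s = s"
  using remdups_adj_snoc_last[OF assms(3)] assms by (simp add: extend_def normalized_iff)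

lemma extend_snoc:
  assumes "normalized s" "last s \<noteq> 2"
  shows "extend s = s @ [2]" "normalized (s @ [2])"
proof -
  show "normalized (s @ [2])" using assms by (simp add: normalized_append normalized_Cons) (simp add: normalized_def)
  then show "extend s = s @ [2]" by (simp add: extend_def normalized_iff)
qed

text \<open>Apart from flipping a whole string that ends in 2, a flip of \<open>s\<close> followed
  by extension is a flip of \<open>extend s\<close> that fixes the final 2. The whole flip is
  estimated by lengths.\<close>

lemma weight_flip_extend:
  assumes "normalized s" "set s = {0, 1, 2}" "flip_step s t"
  shows "weight (extend s) \<le> Suc (weight (extend t))"
proof -
  obtain i where i: "1 \<le> i" "i \<le> length s" "t = flip i s"
    using assms(3) unfolding flip_step_def by blast
  have ne: "s \<noteq> []" using assms(2) by auto
  have len: "3 \<le> length s" using card_length[of s] assms(2) by simp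
  have extend_t: "extend t = remdups_adj (rev (take i s) @ drop i s @ [2])"
    by (simp add: i(3) extend_def flip_def normalization_def remdups_adj_remdups_adj_append)
  show ?thesis
  proof (cases "last s = 2")
    case False
    note ext = extend_snoc[OF assms(1) False]
    have "extend t = flip i (s @ [2])"
      using i(2) by (simp add: extend_t flip_def normalization_def)
    moreover have "set (s @ [2]) = {0, 1, 2}" by (auto simp: assms(2))
    ultimately show ?thesis
      using weight_flip[OF ext(2), of i] i(2) by (simp add: ext(1))
  next
    case True
    note ext = extend_id[OF assms(1) True ne]
    show ?thesis
    proof (cases "i = length s")
      case False
      then have less: "i < length s" using i(2) by simp
      have "extend t = flip i s"
        using remdups_adj_snoc_last[of "rev (take i s) @ drop i s"] less True
        by (simp add: extend_t flip_def normalization_def)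
      then show ?thesis
        using weight_flip[OF assms(1) True assms(2) less] by (simp add: ext)
    next
      case whole: True
      then have t: "extend t = remdups_adj (rev s @ [2])" by (simp add: extend_t)
      show ?thesis
      proof (cases "hd s = 2")
        case True
        then have "last (rev s) = 2" using ne by (simp add: last_rev)
        then have "extend t = rev s"
          using t remdups_adj_snoc_last[of "rev s"] ne assms(1) by (simp add: normalized_iff)
        moreover have "s \<noteq> [0, 2, 1, 2]" using True by auto
        ultimately show ?thesis using len by (intro weight_le_Suc) (simp_all add: ext)
      next
        case False
        have "normalized (rev s @ [2])"
          using assms(1) False ne
          by (simp add: normalized_append normalized_rev normalized_Cons last_rev)
            (simp add: normalized_def)
        \<comment> \<open>The added symbol and the flip itself cover the at most 2 by which
          \<open>weight s\<close> exceeds \<open>length s - 3\<close>.\<close>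
        then have "length (extend t) = Suc (length s)" by (simp add: t normalized_iff)
        then show ?thesis
          using len weight_bounds(1)[of "extend t"] weight_bounds(2)[of s] unfolding ext by linarith
      qed
    qed
  qed
qed

text \<open>The potential is 0 at 012, and each flip lowers it by at most 1.\<close>

lemma weight_lower:
  assumes "(flip_step ^^ k) s [0, 1, 2]" "normalized s" "set s = {0, 1, 2}"
  shows "weight (extend s) \<le> k"
  using assms
proof (induction k arbitrary: s)
  case 0
  then show ?case using bad_short(5) by (simp add: extend_def weight_def)
next
  case (Suc k)
  from Suc.prems(1) obtain t where t: "flip_step s t" "(flip_step ^^ k) t [0, 1, 2]"
    by (rule relpowp_Suc_E2)
  then have "normalized t" "set t = {0, 1, 2}"
    using Suc.prems(3) normalized_flip set_flip by (auto simp: flip_step_def)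
  with Suc.IH[OF t(2)] weight_flip_extend[OF Suc.prems(2,3) t(1)] show ?case by simp
qed

section \<open>The distance from matching bounds\<close>

lemma sorting_dist_eq:
  assumes "(flip_step ^^ n) s [0, 1, 2]" "\<And>k. (flip_step ^^ k) s [0, 1, 2] \<Longrightarrow> n \<le> k"
  shows "sorting_dist s = enat n"
  unfolding sorting_dist_def
proof (rule antisym)
  show "(INF k\<in>{k. (flip_step ^^ k) s [0, 1, 2]}. enat k) \<le> enat n"
    by (rule INF_lower) (use assms(1) in simp)
  show "enat n \<le> (INF k\<in>{k. (flip_step ^^ k) s [0, 1, 2]}. enat k)"
    by (rule INF_greatest) (use assms(2) in simp)
qed

lemma sorting_dist_weight:
  assumes "normalized s" "last s = 2" "set s = {0, 1, 2}"
  shows "sorting_dist s = enat (weight s)"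
proof (rule sorting_dist_eq)
  show "(flip_step ^^ weight s) s [0, 1, 2]" using weight_upper assms by blast
  have "s \<noteq> []" using assms(3) by auto
  then have "extend s = s" using extend_id assms(1,2) by blast
  then show "weight s \<le> k" if "(flip_step ^^ k) s [0, 1, 2]" for k
    using weight_lower[OF that assms(1,3)] by simp
qed

text \<open>The upper bound holds because \<open>s\<close> is a subsequence of
  \<open>s @ [2]\<close>; the lower bound is the potential of the extension, which is
  \<open>s @ [2]\<close> itself.\<close>

lemma sorting_dist_extend:
  assumes "normalized s" "last s \<noteq> 2" "set s = {0, 1, 2}"
  shows "sorting_dist s = sorting_dist (s @ [2])"
proof -
  note ext = extend_snoc(1)[OF assms(1,2)] and norm = extend_snoc(2)[OF assms(1,2)]
  have set: "set (s @ [2]) = {0, 1, 2}" by (auto simp: assms(3))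
  have "sorting_dist s = enat (weight (s @ [2]))"
  proof (rule sorting_dist_eq)
    have "subseq s (s @ [2])" by (simp add: subseq_rev_drop_many)
    from flip_steps_subseq[OF weight_upper[OF norm _ set] this assms(1,3)]
    show "(flip_step ^^ weight (s @ [2])) s [0, 1, 2]" by simp
    show "weight (s @ [2]) \<le> k" if "(flip_step ^^ k) s [0, 1, 2]" for k
      using weight_lower[OF that assms(1,3)] ext by simp
  qed
  then show ?thesis using sorting_dist_weight[OF norm _ set] by simp
qed

lemma fully_ternary_iff: "fully_ternary s \<longleftrightarrow> set s = {0, 1, 2}"
proof -
  have "{0..<3::nat} = {0, 1, 2}" by auto
  then show ?thesis by (simp add: fully_kary_def)
qed

theorem theorem4p4:
  shows "sorting_dist [0,2,1,2] = 3
    \<and> (\<forall>s. normalized s \<and> fully_ternary s \<and> last s = 2 \<and> s \<noteq> [0,2,1,2] \<longrightarrow>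
           (bad s \<longrightarrow> sorting_dist s = enat (length s - 2))
         \<and> (good s \<longrightarrow> sorting_dist s = enat (length s - 3)))
    \<and> (\<forall>s. normalized s \<and> fully_ternary s \<and> (last s = 0 \<or> last s = 1) \<longrightarrow>
           sorting_dist s = sorting_dist (s @ [2]))"
proof (intro conjI allI impI)
  have "bad [0, 2, 1, 2]" by (simp add: bad_iff) code_simp
  then have "weight [0, 2, 1, 2] = 3" by (simp add: weight_def)
  then show "sorting_dist [0, 2, 1, 2] = 3"
    using sorting_dist_weight[of "[0, 2, 1, 2]"]
    by (auto simp: normalized_def numeral_eq_enat)
next
  fix s assume s: "normalized s \<and> fully_ternary s \<and> last s = 2 \<and> s \<noteq> [0, 2, 1, 2]"
  then have d: "sorting_dist s = enat (weight s)"
    using sorting_dist_weight fully_ternary_iff by blast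
  have "3 \<le> length s" using card_length[of s] s by (simp add: fully_ternary_iff)
  then show "bad s \<Longrightarrow> sorting_dist s = enat (length s - 2)"
    using d s by (simp add: weight_def)
  show "good s \<Longrightarrow> sorting_dist s = enat (length s - 3)"
    using d s by (simp add: weight_def good_def)
next
  fix s assume "normalized s \<and> fully_ternary s \<and> (last s = 0 \<or> last s = 1)"
  then show "sorting_dist s = sorting_dist (s @ [2])"
    using sorting_dist_extend[of s] by (auto simp: fully_ternary_iff)
qed

end
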